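(* For any $A,B,B',C,C'\in\widehat{\mathbb{F}_q}$ and any $x\in\mathbb{F}_q\setminus\{1\}$, $$F_{2}(A;B,B';C,C';x,1-x)=CB'C'(-1)\,\overline{A}(1-x)\;{}_{3}F_2\left(\begin{matrix}A,\overline{B}C,A\overline{C'}\\ C,AB'\overline{C'}\end{matrix}\bigg|\,-\frac{x}{1-x}\right).$$
   Context: Let $q$ be a power of a prime, $\mathbb{F}_q$ the field with $q$ elements, and $\widehat{\mathbb{F}_q}$ the group of (complex-valued) multiplicative characters of $\mathbb{F}_q^*$. Every character $\chi$, including the trivial character $\varepsilon$, is extended to $\mathbb{F}_q$ by $\chi(0)=0$. $\overline{\chi}$ denotes the inverse of $\chi$. Products of characters are evaluated pointwise, e.g. $CB'C'(-1)=C(-1)B'(-1)C'(-1)$. Jacobi sum: $J(\chi,\lambda)=\sum_{u\in\mathbb{F}_q}\chi(u)\lambda(1-u)$. Binomial coefficient of characters: $\binom{A}{B}=B(-1)J(A,\overline{B})$. Finite field ${}_3F_2$: for $A_0,A_1,A_2,B_1,B_2\in\widehat{\mathbb{F}_q}$ and $x\in\mathbb{F}_q$, $${}_{3}F_2\left(\begin{matrix}A_0,A_1,A_2\\ B_1,B_2\end{matrix}\bigg|\,x\right)=\frac{1}{q-1}\sum_{\chi}\binom{A_0\chi}{\chi}\binom{A_1\chi}{B_1\chi}\binom{A_2\chi}{B_2\chi}\chi(x),$$ the sum being over all multiplicative characters $\chi$ of $\mathbb{F}_q$. The finite field Appell series $F_2$ is defined, for $A,B,B',C,C'\in\widehat{\mathbb{F}_q}$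 and $x,y\in\mathbb{F}_q$, by $$F_{2}(A;B,B';C,C';x,y)=\varepsilon(xy)\,BB'CC'(-1)\sum_{u,v\in\mathbb{F}_q}B(u)B'(v)\,\overline{B}C(1-u)\,\overline{B'}C'(1-v)\,\overline{A}(1-ux-vy).$$ *)

theory Defs
  imports Complex_Main "HOL-Library.FuncSet" "HOL-Library.Cardinality"
    "HOL-Library.Function_Algebras" "HOL-Library.Function_Division"
begin

text \<open>
  A finite field is a type of sort \<open>{field, finite}\<close>, with \<open>q = CARD('a)\<close>.  A character is
  represented by its extension by zero to the whole field.  Products and inverses of characters
  are those of the function type, i.e. pointwise; since \<open>inverse 0 = 0\<close> in the complex numbers,
  the pointwise inverse is again extended by zero.  The unit of the character group is
  \<open>triv_char\<close>, not the constant function 1.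
\<close>

definition mult_chars :: "('a::{field,finite} \<Rightarrow> complex) set" where
  "mult_chars = {\<chi>. \<chi> 0 = 0 \<and> (\<forall>a. a \<noteq> 0 \<longrightarrow> \<chi> a \<noteq> 0) \<and>
                     (\<forall>a b. a \<noteq> 0 \<longrightarrow> b \<noteq> 0 \<longrightarrow> \<chi> (a * b) = \<chi> a * \<chi> b)}"

definition triv_char :: "'a::{field,finite} \<Rightarrow> complex" where
  "triv_char a = (if a = 0 then 0 else 1)"

lemma triv_char_in_mult_chars: "triv_char \<in> mult_chars"
  by (simp add: mult_chars_def triv_char_def)

lemma mult_in_mult_chars: "A \<in> mult_chars \<Longrightarrow> B \<in> mult_chars \<Longrightarrow> A * B \<in> mult_chars"
  by (simp add: mult_chars_def)

lemma inverse_in_mult_chars: "A \<in> mult_chars \<Longrightarrow> inverse A \<in> mult_chars"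
  by (simp add: mult_chars_def)

lemma mult_triv_char: "A \<in> mult_chars \<Longrightarrow> A * triv_char = A"
  by (auto simp: mult_chars_def triv_char_def fun_eq_iff)

lemma mult_inverse_char: "A \<in> mult_chars \<Longrightarrow> A * inverse A = triv_char"
  by (auto simp: mult_chars_def triv_char_def fun_eq_iff)

definition jacobi_sum :: "('a::{field,finite} \<Rightarrow> complex) \<Rightarrow> ('a \<Rightarrow> complex) \<Rightarrow> complex" where
  "jacobi_sum \<chi> \<psi> = (\<Sum>u\<in>UNIV. \<chi> u * \<psi> (1 - u))"

definition char_binom :: "('a::{field,finite} \<Rightarrow> complex) \<Rightarrow> ('a \<Rightarrow> complex) \<Rightarrow> complex" where
  "char_binom A B = B (-1) * jacobi_sum A (inverse B)"

definition hyp_3F2 ::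
  "('a::{field,finite} \<Rightarrow> complex) \<Rightarrow> ('a \<Rightarrow> complex) \<Rightarrow> ('a \<Rightarrow> complex) \<Rightarrow>
   ('a \<Rightarrow> complex) \<Rightarrow> ('a \<Rightarrow> complex) \<Rightarrow> 'a \<Rightarrow> complex" where
  "hyp_3F2 A\<^sub>0 A\<^sub>1 A\<^sub>2 B\<^sub>1 B\<^sub>2 x =
     1 / (of_nat CARD('a) - 1) *
     (\<Sum>\<chi>\<in>mult_chars.
        char_binom (A\<^sub>0 * \<chi>) \<chi> * char_binom (A\<^sub>1 * \<chi>) (B\<^sub>1 * \<chi>) * char_binom (A\<^sub>2 * \<chi>) (B\<^sub>2 * \<chi>) * \<chi> x)"

definition appell_F2 ::
  "('a::{field,finite} \<Rightarrow> complex) \<Rightarrow> ('a \<Rightarrow> complex) \<Rightarrow> ('a \<Rightarrow> complex) \<Rightarrow>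
   ('a \<Rightarrow> complex) \<Rightarrow> ('a \<Rightarrow> complex) \<Rightarrow> 'a \<Rightarrow> 'a \<Rightarrow> complex" where
  "appell_F2 A B B' C C' x y =
     triv_char (x * y) * (B * B' * C * C') (-1) *
     (\<Sum>u\<in>UNIV. \<Sum>v\<in>UNIV.
        B u * B' v * (inverse B * C) (1 - u) * (inverse B' * C') (1 - v) *
        inverse A (1 - u * x - v * y))"

text \<open>
  \<open>sum\<close> over an infinite set is 0 by convention, so the sum in \<open>hyp_3F2\<close> is only meaningful
  because there are finitely many characters.
\<close>

lemma mult_char_power_card:
  fixes a :: "'a::{field,finite}"
  assumes "\<chi> \<in> mult_chars" "a \<noteq> 0"
  shows "\<chi> a ^ card (UNIV - {0 :: 'a}) = 1"
proof -
  let ?U = "UNIV - {0 :: 'a}"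
  have "bij_betw (\<lambda>b. a * b) ?U ?U"
    by (rule bij_betw_byWitness[where f' = "\<lambda>b. b / a"]) (use assms(2) in auto)
  hence "(\<Prod>b\<in>?U. \<chi> b) = (\<Prod>b\<in>?U. \<chi> (a * b))"
    by (rule prod.reindex_bij_betw[symmetric])
  also have "\<dots> = (\<Prod>b\<in>?U. \<chi> a * \<chi> b)"
    using assms by (intro prod.cong) (auto simp: mult_chars_def)
  also have "\<dots> = \<chi> a ^ card ?U * (\<Prod>b\<in>?U. \<chi> b)"
    by (simp add: prod.distrib)
  finally show ?thesis
    using assms(1) by (auto simp: mult_chars_def)
qed

lemma finite_mult_chars: "finite (mult_chars :: ('a::{field,finite} \<Rightarrow> complex) set)"
proof -
  let ?n = "card (UNIV - {0 :: 'a})"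
  let ?R = "insert 0 {z :: complex. z ^ ?n = 1}"
  have "(1 :: 'a) \<in> UNIV - {0}" by simp
  hence "?n > 0" by (metis card_gt_0_iff empty_iff finite)
  hence "finite ?R"
    using finite_nth_roots[of ?n 1] by simp
  hence "finite (PiE (UNIV :: 'a set) (\<lambda>_. ?R))"
    by (intro finite_PiE) auto
  moreover have "mult_chars \<subseteq> PiE (UNIV :: 'a set) (\<lambda>_. ?R)"
  proof
    fix \<chi> :: "'a \<Rightarrow> complex" assume *: "\<chi> \<in> mult_chars"
    have "\<chi> a \<in> ?R" for a
      using mult_char_power_card[OF *, of a] * by (cases "a = 0") (auto simp: mult_chars_def)
    thus "\<chi> \<in> PiE UNIV (\<lambda>_. ?R)" by auto
  qed
  ultimately show ?thesis by (rule rev_finite_subset)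
qed

end

(* The linear form 1 - u x - v (1 - x) becomes u x + v (1 - x) under u, v -> 1 - u, 1 - v.  Expanding
   inverse A (1 - w) at w = - u x / (v (1 - x)) by the binomial theorem for characters (a consequence of
   orthogonality) separates the variables u and v; the two resulting Jacobi sums are binomial
   coefficients, up to the substitution u -> u / (u - 1). *)

theory Submission
  imports Defs "HOL-Algebra.Multiplicative_Group"
begin

subsection \<open>Orthogonality of characters\<close>

text \<open>The multiplicative group of a finite field is cyclic. The known result is stated for
  carrier-based structures, so the type is repackaged as a record \<open>R\<close> with carrier
  \<open>UNIV\<close>, and powers in \<open>R\<close> are identified with the usual ones.\<close>

lemma finite_field_generator:
  "\<exists>g::'a::{field,finite}. g \<noteq> 0 \<and> (\<forall>a. a \<noteq> 0 \<longrightarrow> (\<exists>i::nat. a = g ^ i))"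
proof -
  define R :: "'a ring" where
    "R = \<lparr>carrier = UNIV, monoid.mult = (*), one = 1, ring.zero = 0, add = (+)\<rparr>"
  have "\<exists>y. x + y = 0" for x :: 'a
    by (rule exI[of _ "- x"]) simp
  moreover have "\<exists>y. x * y = 1" if "x \<noteq> 0" for x :: 'a
    by (rule exI[of _ "Fields.inverse x"]) (use that in simp)
  ultimately interpret R: field R
    unfolding R_def
    by unfold_locales (auto simp: algebra_simps Units_def)
  obtain g where g: "g \<in> carrier (mult_of R)"
    "carrier (mult_of R) = {g [^]\<^bsub>R\<^esub> i | i::nat. i \<in> UNIV}"
    using R.finite_field_mult_group_has_gen by auto
  have pow: "g [^]\<^bsub>R\<^esub> (i::nat) = g ^ i" for i
    by (induction i) (simp_all add: R_def nat_pow_def)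
  have "carrier (mult_of R) = UNIV - {0}"
    by (simp add: R_def)
  with g show ?thesis
    unfolding pow by (intro exI[of _ g]) auto
qed

lemma card_nonzero: "card (UNIV - {0 :: 'a::{field,finite}}) = CARD('a) - 1"
  by (simp add: card_Diff_singleton)

lemma card_nonzero_pos: "card (UNIV - {0 :: 'a::{field,finite}}) > 0"
  by (subst card_gt_0_iff) (auto dest: subsetD[OF _ UNIV_I, of _ 1])

lemma of_nat_card_minus_one_nonzero: "of_nat CARD('a::{field,finite}) - 1 \<noteq> (0 :: complex)"
  using card_nonzero_pos[where 'a = 'a] by (metis card_nonzero eq_iff_diff_eq_0 diff_self_eq_0
      less_irrefl of_nat_eq_1_iff)

text \<open>Stated over an arbitrary monoid because it serves both the generator of the field and
  its complex image, a root of unity.\<close>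

lemma power_mod_exponent:
  fixes w :: "'b::monoid_mult"
  assumes "w ^ n = 1"
  shows "w ^ (m mod n) = w ^ m"
proof -
  have "w ^ m = w ^ (n * (m div n) + m mod n)" by simp
  also have "\<dots> = w ^ (m mod n)" unfolding power_add power_mult assms by simp
  finally show ?thesis by simp
qed

section \<open>Elementary rules for character values\<close>

lemma char_0: "\<chi> \<in> mult_chars \<Longrightarrow> \<chi> 0 = 0"
  by (simp add: mult_chars_def)

lemma char_nonzero: "\<chi> \<in> mult_chars \<Longrightarrow> a \<noteq> 0 \<Longrightarrow> \<chi> a \<noteq> 0"
  by (simp add: mult_chars_def)

text \<open>Extension by zero makes both sides vanish when a factor is 0, so the rule can rewrite
  unconditionally.\<close>

lemma char_mult:
  assumes "\<chi> \<in> mult_chars"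
  shows "\<chi> (a * b) = \<chi> a * \<chi> b"
  using assms by (cases "a = 0 \<or> b = 0") (auto simp: mult_chars_def)

lemma char_1:
  assumes "\<chi> \<in> mult_chars"
  shows "\<chi> 1 = 1"
  using char_mult[OF assms, of 1 1] char_nonzero[OF assms, of 1] by simp

lemma char_inverse:
  assumes "\<chi> \<in> mult_chars"
  shows "\<chi> (inverse a) = inverse (\<chi> a)"
proof (cases "a = 0")
  case False
  hence "\<chi> a * \<chi> (inverse a) = 1"
    using assms by (simp flip: char_mult add: char_1)
  thus ?thesis by (metis inverse_unique)
qed (use assms in \<open>simp add: char_0\<close>)

lemma char_divide: "\<chi> \<in> mult_chars \<Longrightarrow> \<chi> (a / b) = \<chi> a / \<chi> b"
  by (simp add: divide_inverse char_mult char_inverse)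

lemma char_power: "\<chi> \<in> mult_chars \<Longrightarrow> \<chi> (a ^ i) = \<chi> a ^ i"
  by (induction i) (simp_all add: char_1 char_mult)

lemma char_minus_one_sq:
  assumes "\<chi> \<in> mult_chars"
  shows "\<chi> (-1) * \<chi> (-1) = 1"
  using char_mult[OF assms, of "-1" "-1"] char_1[OF assms] by simp

lemma inverse_char_minus_one:
  "\<chi> \<in> mult_chars \<Longrightarrow> inverse (\<chi> (-1)) = \<chi> (-1)"
  by (rule inverse_unique[OF char_minus_one_sq])

section \<open>Characters of a cyclic group and roots of unity\<close>

lemma generator_bij:
  fixes g :: "'a::{field,finite}"
  assumes g: "g \<noteq> 0" "\<And>a. a \<noteq> 0 \<Longrightarrow> \<exists>i::nat. a = g ^ i"
  defines "n \<equiv> card (UNIV - {0::'a})"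
  shows "g ^ n = 1" "bij_betw (\<lambda>i. g ^ i) {..<n} (UNIV - {0})"
proof -
  have npos: "n > 0"
    unfolding n_def by (rule card_nonzero_pos)
  \<comment> \<open>Multiplication by \<open>g\<close> permutes the nonzero elements, so their
    product \<open>P\<close> satisfies \<open>P = g ^ n * P\<close>, and \<open>P\<close> is
    nonzero.\<close>
  have "bij_betw (\<lambda>b. g * b) (UNIV - {0}) (UNIV - {0})"
    by (rule bij_betw_byWitness[where f' = "\<lambda>b. b / g"]) (use g in auto)
  hence "(\<Prod>b\<in>UNIV - {0}. b) = (\<Prod>b\<in>UNIV - {0}. g * b)"
    by (rule prod.reindex_bij_betw[symmetric])
  also have "\<dots> = g ^ n * (\<Prod>b\<in>UNIV - {0}. b)"
    by (simp add: prod.distrib n_def)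
  finally show gn: "g ^ n = 1" by auto
  \<comment> \<open>Exponents reduce modulo \<open>n\<close>, so those below \<open>n\<close> reach
    all \<open>n\<close> nonzero elements; equal cardinalities then force injectivity.\<close>
  from power_mod_exponent[OF gn] have "(\<lambda>i. g ^ i) ` {..<n} = UNIV - {0}"
    using g npos by (fastforce intro: image_eqI[where x = "i mod n" for i, OF sym])
  moreover from this have "inj_on (\<lambda>i. g ^ i) {..<n}"
    by (intro eq_card_imp_inj_on) (simp_all add: n_def)
  ultimately show "bij_betw (\<lambda>i. g ^ i) {..<n} (UNIV - {0})"
    by (simp add: bij_betw_def)
qed

text \<open>Every nonzero element is a power of \<open>g\<close>, so a character is determined by
  its value at \<open>g\<close>. Conversely, for any root of unity \<open>z\<close> of order
  dividing \<open>n\<close>, sending \<open>g ^ i\<close> to \<open>z ^ i\<close> is well defined.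
  Sums over characters thereby become sums over roots of unity.\<close>

lemma chars_bij_roots_of_unity:
  fixes g :: "'a::{field,finite}"
  assumes g: "g \<noteq> 0" "\<And>a. a \<noteq> 0 \<Longrightarrow> \<exists>i::nat. a = g ^ i"
  defines "n \<equiv> card (UNIV - {0::'a})"
  shows "bij_betw (\<lambda>\<chi>. \<chi> g) mult_chars {z. z ^ n = 1}"
  unfolding bij_betw_def
proof
  show "inj_on (\<lambda>\<chi>. \<chi> g) mult_chars"
  proof (rule inj_onI, rule ext)
    fix \<chi> \<psi> :: "'a \<Rightarrow> complex" and a
    assume *: "\<chi> \<in> mult_chars" "\<psi> \<in> mult_chars" "\<chi> g = \<psi> g"
    show "\<chi> a = \<psi> a"
    proof (cases "a = 0")
      case False
      then obtain i :: nat where "a = g ^ i" using g by blast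
      thus ?thesis using * by (simp add: char_power)
    qed (use * in \<open>simp add: char_0\<close>)
  qed
  show "(\<lambda>\<chi>. \<chi> g) ` mult_chars = {z. z ^ n = 1}"
  proof (intro equalityI subsetI)
    fix z assume "z \<in> (\<lambda>\<chi>. \<chi> g) ` mult_chars"
    thus "z \<in> {z. z ^ n = 1}" using mult_char_power_card g by (auto simp: n_def)
  next
    fix z :: complex assume "z \<in> {z. z ^ n = 1}"
    hence zn: "z ^ n = 1" by simp
    note gn = generator_bij(1)[OF g, folded n_def]
    note bij = generator_bij(2)[OF g, folded n_def]
    \<comment> \<open>\<open>k\<close> is the discrete logarithm to base \<open>g\<close>, with
      values below \<open>n\<close>.\<close>
    define k where "k = inv_into {..<n} (\<lambda>i. g ^ i)"
    have gk: "g ^ k a = a" if "a \<noteq> 0" for a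
      using bij_betw_inv_into_right[OF bij, of a] that by (simp add: k_def)
    \<comment> \<open>The logarithm recovers \<open>m\<close> only modulo \<open>n\<close>, which is
      harmless because \<open>z ^ n = 1\<close>.\<close>
    have zk: "z ^ k (g ^ m) = z ^ m" for m
    proof -
      have "n > 0"
        unfolding n_def by (rule card_nonzero_pos)
      hence "k (g ^ m) = m mod n"
        using bij_betw_inv_into_left[OF bij, of "m mod n"] by (simp add: k_def power_mod_exponent[OF gn])
      thus ?thesis by (simp add: power_mod_exponent[OF zn])
    qed
    define \<chi> where "\<chi> = (\<lambda>a. if a = 0 then 0 else z ^ k a)"
    have "z \<noteq> 0"
    proof
      assume "z = 0"
      moreover have "n > 0"
        unfolding n_def by (rule card_nonzero_pos)
      ultimately show False using zn by (simp add: zero_power)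
    qed
    moreover have "z ^ k (a * b) = z ^ k a * z ^ k b" if "a \<noteq> 0" "b \<noteq> 0" for a b
      using zk[of "k a + k b"] that by (simp add: power_add gk)
    ultimately have "\<chi> \<in> mult_chars"
      by (simp add: mult_chars_def \<chi>_def)
    moreover have "\<chi> g = z"
      using zk[of 1] g by (simp add: \<chi>_def)
    ultimately show "z \<in> (\<lambda>\<chi>. \<chi> g) ` mult_chars" by blast
  qed
qed

text \<open>With the roots written as \<open>?r j\<close>, one has
  \<open>?r j ^ k = ?r k ^ j\<close>, so the sum is geometric with ratio \<open>?r k\<close>, an
  \<open>n\<close>-th root of unity. The bounds on \<open>k\<close> make this ratio different from
  \<open>?r 0 = 1\<close>.\<close>

lemma sum_powers_roots_of_unity:
  assumes "0 < k" "k < n"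
  shows "(\<Sum>z | z ^ n = 1. z ^ k) = (0 :: complex)"
proof -
  let ?r = "\<lambda>j::nat. cis (2 * pi * real j / real n)"
  have bij: "bij_betw ?r {..<n} {z. z ^ n = 1}"
    using assms by (intro bij_betw_roots_unity) simp
  have rk: "?r k ^ n = 1"
    using bij_betwE[OF bij] assms by auto
  have "?r k \<noteq> ?r 0"
    using inj_onD[OF bij_betw_imp_inj_on[OF bij], of k 0] assms by auto
  hence rk1: "?r k \<noteq> 1" by simp
  have "(\<Sum>z | z ^ n = 1. z ^ k) = (\<Sum>j<n. ?r j ^ k)"
    by (rule sum.reindex_bij_betw[OF bij, symmetric])
  also have "\<dots> = (\<Sum>j<n. ?r k ^ j)"
    by (intro sum.cong refl) (simp add: DeMoivre mult_ac)
  also have "\<dots> = 0"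
    using rk rk1 by (simp add: geometric_sum)
  finally show ?thesis .
qed

text \<open>Orthogonality: for \<open>a = g ^ k\<close> with \<open>k < n\<close>, the sum becomes
  the sum of \<open>k\<close>-th powers of all \<open>n\<close>-th roots of unity, which is
  \<open>n\<close> for \<open>k = 0\<close> and zero otherwise. At \<open>a = 0\<close> every term
  vanishes.\<close>

lemma sum_mult_chars:
  fixes a :: "'a::{field,finite}"
  shows "(\<Sum>\<chi>\<in>mult_chars. \<chi> a) = (if a = 1 then of_nat CARD('a) - 1 else 0)"
proof (cases "a = 0")
  case False
  obtain g :: 'a where g: "g \<noteq> 0" "\<And>a. a \<noteq> 0 \<Longrightarrow> \<exists>i::nat. a = g ^ i"
    using finite_field_generator by blast
  define n where "n = card (UNIV - {0::'a})"
  note bij = generator_bij(2)[OF g, folded n_def]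
  obtain k where k: "k < n" "a = g ^ k"
    using False bij_betw_imp_surj_on[OF bij] by (metis DiffI UNIV_I imageE lessThan_iff singletonD)
  have "(\<Sum>\<chi>\<in>mult_chars. \<chi> a) = (\<Sum>\<chi>\<in>mult_chars. \<chi> g ^ k)"
    using k by (simp add: char_power)
  also have "\<dots> = (\<Sum>z | z ^ n = 1. z ^ k)"
    by (rule sum.reindex_bij_betw[OF chars_bij_roots_of_unity[OF g, folded n_def]])
  also have "\<dots> = (if a = 1 then of_nat CARD('a) - 1 else 0)"
  proof (cases "k = 0")
    case True
    have "card {z::complex. z ^ n = 1} = n"
      using k by (intro card_roots_unity_eq) simp
    thus ?thesis using True k by (simp add: n_def card_nonzero of_nat_diff Suc_leI)
  next
    case False
    have "a \<noteq> 1"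
      using inj_onD[OF bij_betw_imp_inj_on[OF bij], of k 0] False k by auto
    thus ?thesis using sum_powers_roots_of_unity[of k n] False k by simp
  qed
  finally show ?thesis .
qed (simp add: char_0)

subsection \<open>Jacobi sums and the binomial theorem\<close>

lemma sum_one_minus:
  "(\<Sum>u\<in>UNIV. f (1 - u)) = (\<Sum>u\<in>(UNIV :: 'a::{field,finite} set). f u)"
  by (rule sum.reindex_bij_witness[where i = "\<lambda>u. 1 - u" and j = "\<lambda>u. 1 - u"]) auto

lemma jacobi_sum_commute: "jacobi_sum \<chi> \<psi> = jacobi_sum \<psi> \<chi>"
  unfolding jacobi_sum_def
  using sum_one_minus[of "\<lambda>u. \<psi> u * \<chi> (1 - u)"] by (simp add: mult.commute)

text \<open>The map \<open>u \<mapsto> u / (u - 1)\<close> is an involution of the field without 1.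
  For \<open>w = u / (u - 1)\<close> one has \<open>w = - u / (1 - u)\<close> and
  \<open>1 - w = 1 / (1 - u)\<close>, so the powers of \<open>\<chi> (1 - u)\<close> cancel and only
  the sign \<open>\<chi> (-1)\<close> remains. The terms at 1 vanish on both sides.\<close>

lemma jacobi_sum_reflect:
  fixes \<chi> \<psi> :: "'a::{field,finite} \<Rightarrow> complex"
  assumes "\<chi> \<in> mult_chars" "\<psi> \<in> mult_chars"
  shows "jacobi_sum \<chi> \<psi> = \<chi> (-1) * jacobi_sum \<chi> (inverse (\<chi> * \<psi>))"
proof -
  have "jacobi_sum \<chi> \<psi> = (\<Sum>u\<in>UNIV - {1}. \<chi> u * \<psi> (1 - u))"
    unfolding jacobi_sum_def using assms by (intro sum.mono_neutral_right) (auto simp: char_0)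
  also have "\<dots> = (\<Sum>w\<in>UNIV - {1}. \<chi> (-1) * (\<chi> w * inverse (\<chi> * \<psi>) (1 - w)))"
  proof (rule sum.reindex_bij_witness[where i = "\<lambda>w. w / (w - 1)" and j = "\<lambda>w. w / (w - 1)"])
    fix u :: 'a assume u: "u \<in> UNIV - {1}"
    hence "u - 1 \<noteq> 0" by simp
    show "u / (u - 1) / (u / (u - 1) - 1) = u" "u / (u - 1) / (u / (u - 1) - 1) = u"
      using \<open>u - 1 \<noteq> 0\<close> by (simp_all add: divide_simps)
    show "u / (u - 1) \<in> UNIV - {1}" "u / (u - 1) \<in> UNIV - {1}"
      using \<open>u - 1 \<noteq> 0\<close> by (simp_all add: divide_simps)
    have nz: "1 - u \<noteq> 0" using u by simp
    have "u / (u - 1) = (-1) * u / (1 - u)"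
      using nz \<open>u - 1 \<noteq> 0\<close> by (simp add: divide_simps) (simp add: algebra_simps)
    hence 1: "\<chi> (u / (u - 1)) = \<chi> (-1) * \<chi> u / \<chi> (1 - u)"
      by (simp only: char_divide char_mult assms)
    have 2: "1 - u / (u - 1) = inverse (1 - u)"
      using nz \<open>u - 1 \<noteq> 0\<close> by (simp add: divide_simps)
    have *: "\<chi> (- 1) * (\<chi> (u / (u - 1)) * inverse (\<chi> * \<psi>) (1 - u / (u - 1))) =
        \<chi> (-1) * \<chi> (-1) * \<chi> u * \<psi> (1 - u)"
      unfolding 1 2 using assms nz by (simp add: char_inverse char_nonzero)
    show "\<chi> (- 1) * (\<chi> (u / (u - 1)) * inverse (\<chi> * \<psi>) (1 - u / (u - 1))) =
        \<chi> u * \<psi> (1 - u)"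
      unfolding * using char_minus_one_sq[OF assms(1)] by simp
  qed
  also have "\<dots> = (\<Sum>w\<in>UNIV. \<chi> (-1) * (\<chi> w * inverse (\<chi> * \<psi>) (1 - w)))"
    using assms by (intro sum.mono_neutral_left) (auto simp: char_0)
  finally show ?thesis
    by (simp add: jacobi_sum_def sum_distrib_left)
qed

text \<open>Once the Jacobi sums are written out, all occurrences of \<open>\<chi>\<close> combine
  into its value at \<open>- w u / (1 - u)\<close>. Orthogonality keeps only the \<open>u\<close>
  where this is 1, namely \<open>u = 1 / (1 - w)\<close>. At \<open>w = 0\<close> the right-hand
  side would be 0 but the left-hand side 1.\<close>

lemma char_binomial_theorem:
  fixes w :: "'a::{field,finite}"
  assumes A: "A \<in> mult_chars" and w: "w \<noteq> 0"
  shows "inverse (A (1 - w)) =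
    1 / (of_nat CARD('a) - 1) * (\<Sum>\<chi>\<in>mult_chars. char_binom (A * \<chi>) \<chi> * \<chi> w)"
proof -
  let ?q = "of_nat CARD('a) - 1 :: complex"
  have "(\<Sum>\<chi>\<in>mult_chars. char_binom (A * \<chi>) \<chi> * \<chi> w) =
      (\<Sum>\<chi>\<in>mult_chars. \<Sum>u\<in>UNIV. A u * \<chi> ((-1) * w * u / (1 - u)))"
    \<comment> \<open>The rules simplifying products with -1 are disabled so that
      \<open>char_mult\<close> can split off \<open>\<chi> (-1)\<close>.\<close>
    by (intro sum.cong refl)
      (simp add: char_binom_def jacobi_sum_def sum_distrib_left sum_distrib_right char_mult
        char_divide divide_inverse[of "_ :: complex"] mult_ac
        del: mult_minus_left mult_minus1 mult_minus_right mult_minus1_right)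
  also have "\<dots> = (\<Sum>u\<in>UNIV. A u * (\<Sum>\<chi>\<in>mult_chars. \<chi> ((-1) * w * u / (1 - u))))"
    by (subst sum.swap) (simp add: sum_distrib_left)
  also have "\<dots> = (\<Sum>u\<in>UNIV. if u = inverse (1 - w) then A u * ?q else 0)"
  proof (rule sum.cong[OF refl])
    fix u :: 'a
    have "(-1) * w * u / (1 - u) = 1 \<longleftrightarrow> u = inverse (1 - w)" if "w \<noteq> 1"
      using that w by (auto simp: divide_simps algebra_simps)
    \<comment> \<open>For \<open>w = 1\<close> no \<open>u\<close> qualifies. There
      \<open>inverse (1 - w)\<close> is 0 by convention, and the spurious term at
      \<open>u = 0\<close> is killed by \<open>A 0 = 0\<close>.\<close>
    moreover have "(-1) * w * u / (1 - u) \<noteq> 1" if "w = 1"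
      using that by (auto simp: divide_simps)
    ultimately show "A u * (\<Sum>\<chi>\<in>mult_chars. \<chi> ((-1) * w * u / (1 - u))) =
        (if u = inverse (1 - w) then A u * ?q else 0)"
      unfolding sum_mult_chars using char_0[OF A] by (cases "w = 1") auto
  qed
  also have "\<dots> = inverse (A (1 - w)) * ?q"
    using A by (simp add: char_inverse)
  finally show ?thesis using of_nat_card_minus_one_nonzero[where 'a = 'a] by simp
qed

text \<open>Reflection yields the Jacobi sum inside the binomial coefficient; the two factors
  \<open>\<psi> (-1)\<close> cancel.\<close>

lemma jacobi_sum_eq_char_binom:
  assumes "\<chi> \<in> mult_chars" "\<psi> \<in> mult_chars"
  shows "jacobi_sum \<chi> \<psi> = \<psi> (-1) * char_binom \<chi> (\<chi> * \<psi>)"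
  using jacobi_sum_reflect[OF assms] char_minus_one_sq[OF assms(2)]
  by (simp add: char_binom_def mult_ac)

text \<open>Here reflection is applied with \<open>inverse (\<chi> * \<psi>)\<close> as first
  character. Its sign is exactly the one built into \<open>char_binom\<close>, so no extra sign
  appears.\<close>

lemma jacobi_sum_inverse_eq_char_binom:
  assumes "\<chi> \<in> mult_chars" "\<psi> \<in> mult_chars"
  shows "jacobi_sum (inverse (\<chi> * \<psi>)) \<psi> = char_binom \<chi> (\<chi> * \<psi>)"
proof -
  have "inverse (inverse (\<chi> * \<psi>) * \<psi>) = \<chi>"
  proof
    fix a show "inverse (inverse (\<chi> * \<psi>) * \<psi>) a = \<chi> a"
      using assms by (cases "a = 0") (simp_all add: char_0 char_nonzero)
  qed
  thus ?thesis
    using jacobi_sum_reflect[of "inverse (\<chi> * \<psi>)" \<psi>] assms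
    by (simp add: mult_in_mult_chars inverse_in_mult_chars char_binom_def inverse_char_minus_one
        jacobi_sum_commute)
qed

text \<open>\<open>inverse B * B\<close> is \<open>triv_char\<close> rather than the constant 1; it
  is absorbed because \<open>C\<close> vanishes at 0.\<close>

lemma char_product_cancel:
  assumes "B \<in> mult_chars" "C \<in> mult_chars"
  shows "inverse B * C * \<chi> * B = C * \<chi>"
proof
  fix a show "(inverse B * C * \<chi> * B) a = (C * \<chi>) a"
    using assms by (cases "a = 0") (simp_all add: char_0 char_nonzero)
qed

section \<open>Reduction of \<open>appell_F2\<close> to \<open>hyp_3F2\<close>\<close>

theorem theorem3p5:
  fixes A B B' C C' :: "'a::{field,finite} \<Rightarrow> complex" and x :: 'a
  assumes "A \<in> mult_chars" "B \<in> mult_chars" "B' \<in> mult_chars" "C \<in> mult_chars" "C' \<in> mult_chars"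
    and "x \<noteq> 1"
  shows "appell_F2 A B B' C C' x (1 - x) =
         (C * B' * C') (-1) * inverse A (1 - x) *
         hyp_3F2 A (inverse B * C) (A * inverse C') C (A * B' * inverse C') (- (x / (1 - x)))"
proof (cases "x = 0")
  case True
  \<comment> \<open>Both sides are 0: the left by the factor \<open>triv_char (x * y)\<close>, the
    right because every character vanishes at 0.\<close>
  thus ?thesis by (simp add: appell_F2_def hyp_3F2_def triv_char_def char_0)
next
  case False
  define z where "z = - (x / (1 - x))"
  have x: "x \<noteq> 0" "1 - x \<noteq> 0" and z: "z \<noteq> 0"
    using False assms(6) by (auto simp: z_def)
  let ?q = "of_nat CARD('a) - 1 :: complex"
  let ?f = "\<lambda>\<chi>. char_binom (A * \<chi>) \<chi> * \<chi> z"
  \<comment> \<open>\<open>?D \<chi>\<close> collects the characters evaluated at \<open>v\<close>: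
    those of \<open>inverse B' * C'\<close>, of \<open>inverse A\<close>, and of
    \<open>\<chi> (z * u / v)\<close>.\<close>
  let ?D = "\<lambda>\<chi>. inverse ((A * inverse C' * \<chi>) * B')"
  have expand: "B (1 - u) * B' (1 - v) * (inverse B * C) u * (inverse B' * C') v *
      inverse A (1 - (1 - u) * x - (1 - v) * (1 - x)) =
      inverse A (1 - x) / ?q * (\<Sum>\<chi>\<in>mult_chars. ?f \<chi> *
        ((inverse B * C * \<chi>) u * B (1 - u)) * (?D \<chi> v * B' (1 - v)))" for u v
  \<comment> \<open>If \<open>u\<close> or \<open>v\<close> is 0, both sides vanish. Otherwise
    division by \<open>v\<close> is legitimate and \<open>z * u / v\<close> is nonzero, as the
    binomial theorem requires.\<close>
  proof (cases "u = 0 \<or> v = 0")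
    case True
    thus ?thesis using assms by (auto simp: char_0)
  next
    case False
    have "1 - (1 - u) * x - (1 - v) * (1 - x) = (1 - x) * v * (1 - z * u / v)"
      using False x by (simp add: z_def divide_simps) (simp add: algebra_simps)
    hence "inverse A (1 - (1 - u) * x - (1 - v) * (1 - x)) =
        inverse A (1 - x) * inverse A v * inverse (A (1 - z * u / v))"
      using assms(1) by (simp add: char_mult)
    also have "inverse (A (1 - z * u / v)) =
        1 / ?q * (\<Sum>\<chi>\<in>mult_chars. char_binom (A * \<chi>) \<chi> * \<chi> (z * u / v))"
      using False z by (intro char_binomial_theorem assms(1)) auto
    finally have "B (1 - u) * B' (1 - v) * (inverse B * C) u * (inverse B' * C') v *
        inverse A (1 - (1 - u) * x - (1 - v) * (1 - x)) =
        inverse A (1 - x) / ?q * (\<Sum>\<chi>\<in>mult_chars.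
          B (1 - u) * B' (1 - v) * (inverse B * C) u * (inverse B' * C') v * inverse A v *
          (char_binom (A * \<chi>) \<chi> * \<chi> (z * u / v)))"
      by (simp add: sum_distrib_left mult_ac)
    also have "(\<Sum>\<chi>\<in>mult_chars.
          B (1 - u) * B' (1 - v) * (inverse B * C) u * (inverse B' * C') v * inverse A v *
          (char_binom (A * \<chi>) \<chi> * \<chi> (z * u / v))) =
        (\<Sum>\<chi>\<in>mult_chars. ?f \<chi> *
          ((inverse B * C * \<chi>) u * B (1 - u)) * (?D \<chi> v * B' (1 - v)))"
      by (intro sum.cong refl) (simp add: char_mult char_divide divide_inverse[of "_ :: complex"] mult_ac)
    finally show ?thesis .
  qed
  have "(\<Sum>u\<in>UNIV. \<Sum>v\<in>UNIV. B u * B' v * (inverse B * C) (1 - u) * (inverse B' * C') (1 - v) *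
        inverse A (1 - u * x - v * (1 - x))) =
      (\<Sum>u\<in>UNIV. \<Sum>v\<in>UNIV. B (1 - u) * B' (1 - v) * (inverse B * C) u * (inverse B' * C') v *
        inverse A (1 - (1 - u) * x - (1 - v) * (1 - x)))"
    by (subst sum_one_minus[symmetric], rule sum.cong[OF refl], subst sum_one_minus[symmetric]) simp
  also have "\<dots> = inverse A (1 - x) / ?q * (\<Sum>u\<in>UNIV. \<Sum>v\<in>UNIV. \<Sum>\<chi>\<in>mult_chars. ?f \<chi> *
        ((inverse B * C * \<chi>) u * B (1 - u)) * (?D \<chi> v * B' (1 - v)))"
    unfolding expand by (simp only: sum_distrib_left)
  also have "(\<Sum>u\<in>UNIV. \<Sum>v\<in>UNIV. \<Sum>\<chi>\<in>mult_chars. ?f \<chi> *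
        ((inverse B * C * \<chi>) u * B (1 - u)) * (?D \<chi> v * B' (1 - v))) =
      (\<Sum>u\<in>UNIV. \<Sum>\<chi>\<in>mult_chars. \<Sum>v\<in>UNIV. ?f \<chi> *
        ((inverse B * C * \<chi>) u * B (1 - u)) * (?D \<chi> v * B' (1 - v)))"
    by (rule sum.cong[OF refl]) (rule sum.swap)
  also have "\<dots> = (\<Sum>\<chi>\<in>mult_chars. \<Sum>u\<in>UNIV. \<Sum>v\<in>UNIV. ?f \<chi> *
        ((inverse B * C * \<chi>) u * B (1 - u)) * (?D \<chi> v * B' (1 - v)))"
    by (rule sum.swap)
  \<comment> \<open>For fixed \<open>\<chi>\<close> the summand is a function of \<open>u\<close>
    times a function of \<open>v\<close>, so the double sum factors.\<close>
  also have "\<dots> = (\<Sum>\<chi>\<in>mult_chars. ?f \<chi> * jacobi_sum (inverse B * C * \<chi>) B * jacobi_sum (?D \<chi>) B')"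
    unfolding jacobi_sum_def mult.assoc[of "?f _"] sum_product
    by (simp only: sum_distrib_left mult.assoc)
  also have "\<dots> = (\<Sum>\<chi>\<in>mult_chars. B (-1) * (char_binom (A * \<chi>) \<chi> *
      char_binom (inverse B * C * \<chi>) (C * \<chi>) *
      char_binom (A * inverse C' * \<chi>) (A * B' * inverse C' * \<chi>) * \<chi> z))"
  proof (rule sum.cong[OF refl])
    fix \<chi> :: "'a \<Rightarrow> complex" assume \<chi>: "\<chi> \<in> mult_chars"
    have "jacobi_sum (inverse B * C * \<chi>) B = B (-1) * char_binom (inverse B * C * \<chi>) (C * \<chi>)"
      using assms \<chi> by (simp add: jacobi_sum_eq_char_binom mult_in_mult_chars
          inverse_in_mult_chars char_product_cancel)
    moreover have eq: "A * inverse C' * \<chi> * B' = A * B' * inverse C' * \<chi>"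
      by (simp only: mult_ac)
    have "jacobi_sum (?D \<chi>) B' =
        char_binom (A * inverse C' * \<chi>) (A * B' * inverse C' * \<chi>)"
      using assms \<chi> jacobi_sum_inverse_eq_char_binom[of "A * inverse C' * \<chi>" B']
      unfolding eq by (simp add: mult_in_mult_chars inverse_in_mult_chars)
    ultimately show "?f \<chi> * jacobi_sum (inverse B * C * \<chi>) B * jacobi_sum (?D \<chi>) B' =
      B (-1) * (char_binom (A * \<chi>) \<chi> * char_binom (inverse B * C * \<chi>) (C * \<chi>) *
      char_binom (A * inverse C' * \<chi>) (A * B' * inverse C' * \<chi>) * \<chi> z)"
      by (simp only: mult_ac)
  qed
  also have "\<dots> = B (-1) * (?q * hyp_3F2 A (inverse B * C) (A * inverse C') C (A * B' * inverse C') z)"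
    using of_nat_card_minus_one_nonzero[where 'a = 'a]
    by (simp add: hyp_3F2_def sum_distrib_left[symmetric])
  finally have "appell_F2 A B B' C C' x (1 - x) = (B * B' * C * C') (-1) *
      (inverse A (1 - x) / ?q *
        (B (-1) * (?q * hyp_3F2 A (inverse B * C) (A * inverse C') C (A * B' * inverse C') z)))"
    using x by (simp add: appell_F2_def triv_char_def)
  \<comment> \<open>One \<open>B (-1)\<close> comes from the prefactor of \<open>appell_F2\<close>,
    the other from the Jacobi sum over \<open>u\<close>; their product is 1, so \<open>B\<close>
    drops out of the sign.\<close>
  also have "\<dots> = (B (-1) * B (-1)) * ((C * B' * C') (-1) * inverse A (1 - x) *
      hyp_3F2 A (inverse B * C) (A * inverse C') C (A * B' * inverse C') z)"
    using of_nat_card_minus_one_nonzero[where 'a = 'a] by simp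
  finally show ?thesis
    unfolding char_minus_one_sq[OF assms(2)] z_def by simp
qed

end
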